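(* Let $x^\star\in X$ and let $y^\star\in\partial_\Phi f(x^\star)$. (a) If $x^\star$ is a global minimizer of $F=g-f$ over $X$, then $g(x)\ge g(x^\star)+\Phi(x,y^\star)-\Phi(x^\star,y^\star)$ for all $x\in X$. (b) If $x^\star$ is a local minimizer of $F$ over $X$, then there is a neighborhood $U$ of $x^\star$ such that $g(x)\ge g(x^\star)+\Phi(x,y^\star)-\Phi(x^\star,y^\star)$ for all $x\in X\cap U$.
   Context: Setting. $X\subseteq\mathbb{R}^n$ and $Y\subseteq\mathbb{R}^m$ are nonempty and $\Phi:X\times Y\to\mathbb{R}$ is jointly continuous relative to $X\times Y$. $\overline{\mathbb{R}}=\mathbb{R}\cup\{\pm\infty\}$. A function is proper if it never takes the value $-\infty$ and is not identically $+\infty$. A function $f:X\to\overline{\mathbb{R}}$ is $\Phi$-convex if there are an index set $I$ and $(y_i,\beta_i)\in Y\times\overline{\mathbb{R}}$, $i\in I$, with $f(x)=\sup_{i\in I}\Phi(x,y_i)-\beta_i$ for all $x\in X$ (and $f\equiv-\infty$ if $I=\emptyset$). Standing assumptions: $f:X\to\overline{\mathbb{R}}$ is proper and $\Phi$-convex; $g:X\to\overline{\mathbb{R}}$ is proper and lower semicontinuous relative to $X$, and there exist $y\in Y$, $\beta\in\mathbb{R}$ with $g\ge\Phi(\cdot,y)-\beta$ on $X$; $F:=g-f$ (with the convention $g(x)-f(x)=+\infty$ if both values are $+\infty$) satisfies $-\infty<\inf_X F<\infty$. $\Phi$-subdifferential: $y\in\partial_\Phi f(\bar x)$ iff $y\in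 Y$ and $f(x)\ge f(\bar x)+\Phi(x,y)-\Phi(\bar x,y)$ for all $x\in X$. *)

theory Defs
  imports "HOL-Analysis.Analysis"
begin

definition proper_on :: "'a set \<Rightarrow> ('a \<Rightarrow> ereal) \<Rightarrow> bool" where
  "proper_on X f \<longleftrightarrow> (\<forall>x\<in>X. f x \<noteq> -\<infinity>) \<and> (\<exists>x\<in>X. f x \<noteq> \<infinity>)"

text \<open>The filter \<^term>\<open>at x within X\<close> leaves out \<open>x\<close> itself, which does not matter for the
  inequality below; at isolated points of \<open>X\<close> the right-hand side is \<open>\<infinity>\<close>.\<close>

definition lsc_on :: "'a::topological_space set \<Rightarrow> ('a \<Rightarrow> ereal) \<Rightarrow> bool" where
  "lsc_on X f \<longleftrightarrow> (\<forall>x\<in>X. f x \<le> Liminf (at x within X) f)"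

text \<open>A family \<open>(y\<^sub>i, \<beta>\<^sub>i)\<close> enters only through its range, so the set of parameter pairs serves as its
  own index set; \<open>Phi_convex_on_family\<close> recovers the formulation with an arbitrary index set.
  For \<open>S = {}\<close> the supremum is \<open>-\<infinity>\<close>.\<close>

definition Phi_convex_on ::
  "'a set \<Rightarrow> 'b set \<Rightarrow> ('a \<times> 'b \<Rightarrow> real) \<Rightarrow> ('a \<Rightarrow> ereal) \<Rightarrow> bool" where
  "Phi_convex_on X Y \<Phi> f \<longleftrightarrow>
     (\<exists>S :: ('b \<times> ereal) set. S \<subseteq> Y \<times> UNIV \<and>
        (\<forall>x\<in>X. f x = (SUP (y, \<beta>)\<in>S. ereal (\<Phi> (x, y)) - \<beta>)))"

lemma Phi_convex_on_family:
  fixes \<beta> :: "'i \<Rightarrow> ereal"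
  assumes "\<And>i. i \<in> I \<Longrightarrow> y i \<in> Y"
    and "\<And>x. x \<in> X \<Longrightarrow> f x = (SUP i\<in>I. ereal (\<Phi> (x, y i)) - \<beta> i)"
  shows "Phi_convex_on X Y \<Phi> f"
  unfolding Phi_convex_on_def
  by (rule exI[of _ "(\<lambda>i. (y i, \<beta> i)) ` I"]) (use assms in \<open>auto simp: image_image\<close>)

definition Phi_subdiff ::
  "'a set \<Rightarrow> 'b set \<Rightarrow> ('a \<times> 'b \<Rightarrow> real) \<Rightarrow> ('a \<Rightarrow> ereal) \<Rightarrow> 'a \<Rightarrow> 'b set" where
  "Phi_subdiff X Y \<Phi> f x0 =
     {y \<in> Y. \<forall>x\<in>X. f x \<ge> f x0 + ereal (\<Phi> (x, y)) - ereal (\<Phi> (x0, y))}"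

definition global_minimizer_on :: "'a set \<Rightarrow> ('a \<Rightarrow> ereal) \<Rightarrow> 'a \<Rightarrow> bool" where
  "global_minimizer_on X F x0 \<longleftrightarrow> x0 \<in> X \<and> (\<forall>x\<in>X. F x0 \<le> F x)"

definition local_minimizer_on :: "'a::topological_space set \<Rightarrow> ('a \<Rightarrow> ereal) \<Rightarrow> 'a \<Rightarrow> bool" where
  "local_minimizer_on X F x0 \<longleftrightarrow>
     x0 \<in> X \<and> (\<exists>U. open U \<and> x0 \<in> U \<and> (\<forall>x\<in>X \<inter> U. F x0 \<le> F x))"

text \<open>Subtraction on \<^typ>\<open>ereal\<close> already follows the convention required for \<open>g - f\<close>.\<close>

lemma ereal_PInf_minus_PInf: "(\<infinity>::ereal) - \<infinity> = \<infinity>"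
  by simp

end

theory Submission
  imports Defs
begin

text \<open>Where \<open>F\<close> does not drop below its value at \<open>x\<^sup>\<star>\<close>, the increase of \<open>g\<close> is at least that
  of \<open>f\<close>, and the \<open>\<Phi>\<close>-subgradient inequality bounds the increase of \<open>f\<close> from below by that of
  \<open>\<Phi>(\<cdot>, y\<^sup>\<star>)\<close>. This is one point at a time, so global and local minimizers are treated alike.
  Only infinite values can interfere with the arithmetic. A proper function has a finite value
  wherever it has a \<open>\<Phi>\<close>-subgradient (\<open>proper_on_Phi_subdiff_finite\<close>). Away from \<open>x\<^sup>\<star>\<close>,
  \<open>f(x) = \<infinity>\<close> forces \<open>g(x) = \<infinity>\<close>, since otherwise \<open>F(x) = -\<infinity>\<close>, and \<open>F\<close> is bounded below; this
  is the degenerate case of \<open>increase_transfers_to_minuend\<close>.\<close>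

text \<open>If \<open>f\<close> were \<open>\<infinity>\<close> at \<open>x0\<close>, the subgradient inequality would make it \<open>\<infinity>\<close> on all of \<open>X\<close>.\<close>

lemma proper_on_Phi_subdiff_finite:
  assumes "proper_on X f" and "x0 \<in> X" and "y \<in> Phi_subdiff X Y \<Phi> f x0"
  shows "\<bar>f x0\<bar> \<noteq> \<infinity>"
proof -
  have "f x0 \<noteq> \<infinity>"
  proof
    assume "f x0 = \<infinity>"
    then have "\<forall>x\<in>X. f x = \<infinity>"
      using assms(3) by (auto simp: Phi_subdiff_def)
    with assms(1) show False
      by (auto simp: proper_on_def)
  qed
  moreover have "f x0 \<noteq> -\<infinity>"
    using assms(1,2) by (auto simp: proper_on_def)
  ultimately show ?thesis
    by auto
qed

text \<open>Read \<open>a, b\<close> as the values of \<open>f\<close>, and \<open>u, v\<close> as those of \<open>g\<close>, at the reference point and at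
  another point; \<open>p, q\<close> are the values of \<open>\<Phi>(\<cdot>, y)\<close> at the other point and at the reference point.
  For real values, add the inequalities. If \<open>b = \<infinity>\<close>, only \<open>v = \<infinity>\<close> is compatible with
  \<open>v - b \<noteq> -\<infinity>\<close>; if \<open>u = \<infinity>\<close>, the comparison of the differences forces \<open>v = \<infinity>\<close>.\<close>

lemma increase_transfers_to_minuend:
  fixes a b u v :: ereal and p q :: real
  assumes "\<bar>a\<bar> \<noteq> \<infinity>" and "a + ereal p - ereal q \<le> b"
    and "u - a \<le> v - b" and "v - b \<noteq> -\<infinity>"
  shows "u + ereal p - ereal q \<le> v"
  using assms by (cases a; cases b; cases u; cases v) auto

theorem proposition3p3:
  fixes X :: "(real ^ 'n) set" and Y :: "(real ^ 'm) set"
    and \<Phi> :: "(real ^ 'n) \<times> (real ^ 'm) \<Rightarrow> real"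
    and f g F :: "real ^ 'n \<Rightarrow> ereal"
    and xs :: "real ^ 'n" and ys :: "real ^ 'm"
  assumes "X \<noteq> {}" and "Y \<noteq> {}"
    and "continuous_on (X \<times> Y) \<Phi>"
    and "proper_on X f" and "Phi_convex_on X Y \<Phi> f"
    and "proper_on X g" and "lsc_on X g"
    and "\<exists>y\<in>Y. \<exists>\<beta>::real. \<forall>x\<in>X. g x \<ge> ereal (\<Phi> (x, y) - \<beta>)"
    and F_def: "F = (\<lambda>x. g x - f x)"
    and "-\<infinity> < (INF x\<in>X. F x)" and "(INF x\<in>X. F x) < \<infinity>"
    and "xs \<in> X" and "ys \<in> Phi_subdiff X Y \<Phi> f xs"
  shows "(global_minimizer_on X F xs \<longrightarrow>
            (\<forall>x\<in>X. g x \<ge> g xs + ereal (\<Phi> (x, ys)) - ereal (\<Phi> (xs, ys)))) \<and>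
         (local_minimizer_on X F xs \<longrightarrow>
            (\<exists>U. open U \<and> xs \<in> U \<and>
               (\<forall>x\<in>X \<inter> U. g x \<ge> g xs + ereal (\<Phi> (x, ys)) - ereal (\<Phi> (xs, ys)))))"
proof -
  have finite: "\<bar>f xs\<bar> \<noteq> \<infinity>"
    using assms(4,12,13) by (rule proper_on_Phi_subdiff_finite)
  have pointwise: "g xs + ereal (\<Phi> (x, ys)) - ereal (\<Phi> (xs, ys)) \<le> g x"
    if "x \<in> X" and "F xs \<le> F x" for x
  proof (rule increase_transfers_to_minuend[OF finite])
    show "f xs + ereal (\<Phi> (x, ys)) - ereal (\<Phi> (xs, ys)) \<le> f x"
      using assms(13) \<open>x \<in> X\<close> by (simp add: Phi_subdiff_def)
    show "g xs - f xs \<le> g x - f x"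
      using \<open>F xs \<le> F x\<close> by (simp add: F_def)
    have "-\<infinity> < F x"
      using assms(10) INF_lower[OF \<open>x \<in> X\<close>] by (rule less_le_trans)
    then show "g x - f x \<noteq> -\<infinity>"
      by (simp add: F_def)
  qed
  show ?thesis
    unfolding global_minimizer_on_def local_minimizer_on_def
    using pointwise by (meson IntD1)
qed

end
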